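(* Let $(X,E(X))$ be an infinite, connected, locally finite, non-oriented graph such that there exists $x\in X$ satisfying $$\sup_{n\in\mathbb N}\frac{|S(x,n+1)|}{|B(x,n)|}<+\infty .$$ Then the classification on the average (over balls centred at $o$) of any random walk on $X$ is independent of the choice of $o$; that is, for every random walk $(X,P)$ and all $o,o'\in X$, $(X,P)$ is TOA with respect to $o$ if and only if it is TOA with respect to $o'$ (equivalently, ROA with respect to $o$ if and only if ROA with respect to $o'$).
   Context: $B(x,n)$ and $S(x,n)$ are the closed ball and the sphere of centre $x$ and radius $n$ in the graph distance, and $|\cdot|$ is cardinality. A random walk $(X,P)$ is a Markov chain on the vertex set $X$ with stochastic transition matrix $P=(p(x,y))_{x,y\in X}$; it is not assumed to be adapted to (i.e. related to the edges of) the graph. For $n\ge 1$, $f^{(n)}(x,x)$ is the probability that the walk started at $x$ returns to $x$ for the first time at time $n$, and $F(x,x)=\sum_{n\ge1}f^{(n)}(x,x)\in[0,1]$. For $o\in X$ put $$\mathrm{inf}L_o(F)=\liminf_{n\to\infty}\frac1{|B(o,n)|}\sum_{x\in B(o,n)}F(x,x).$$ $(X,P)$ is transient on the average (TOA) with respect to $o$ if $\mathrm{inf}L_o(F)<1$, and recurrent on the average (ROA) with respect to $o$ if $\mathrm{inf}L_o(F)=1$. *)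

theory Defs
  imports
    "HOL-Probability.Probability"
    "Graph_Theory.Digraph_Component"
    "Graph_Theory.Shortest_Path"
begin

section \<open>Non-oriented graphs and the graph distance\<close>

text \<open>
  A non-oriented graph with vertex set \<open>pverts G\<close> and edge set
  \<open>parcs G \<subseteq> pverts G \<times> pverts G\<close> is a \<^locale>\<open>pair_sym_digraph\<close>: each edge is
  represented by both of its orientations. Loops are permitted; they do not affect distances.
\<close>

definition locally_finite_graph :: "'a pair_pre_digraph \<Rightarrow> bool" where
  "locally_finite_graph G \<longleftrightarrow> (\<forall>x\<in>pverts G. finite (out_arcs (with_proj G) x))"

text \<open>With unit edge costs, the cost of a walk is its number of edges.\<close>

definition graph_dist :: "'a pair_pre_digraph \<Rightarrow> 'a \<Rightarrow> 'a \<Rightarrow> ereal" where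
  "graph_dist G x y = wf_digraph.\<mu> (with_proj G) (\<lambda>_. 1) x y"

definition graph_ball :: "'a pair_pre_digraph \<Rightarrow> 'a \<Rightarrow> nat \<Rightarrow> 'a set" where
  "graph_ball G x n = {y \<in> pverts G. graph_dist G x y \<le> ereal (real n)}"

definition graph_sphere :: "'a pair_pre_digraph \<Rightarrow> 'a \<Rightarrow> nat \<Rightarrow> 'a set" where
  "graph_sphere G x n = {y \<in> pverts G. graph_dist G x y = ereal (real n)}"


section \<open>Random walks\<close>

definition stochastic_matrix :: "'a set \<Rightarrow> ('a \<Rightarrow> 'a \<Rightarrow> real) \<Rightarrow> bool" where
  "stochastic_matrix X p \<longleftrightarrow>
     (\<forall>x\<in>X. (\<forall>y\<in>X. 0 \<le> p x y) \<and> ((\<lambda>y. p x y) has_sum 1) X)"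

text \<open>
  The law of one step from \<open>x\<close>. This is meaningful for a stochastic matrix on \<open>X\<close> and \<open>x \<in> X\<close>;
  the entries of \<open>p\<close> outside \<open>X \<times> X\<close> are irrelevant.
\<close>

definition step_law :: "'a set \<Rightarrow> ('a \<Rightarrow> 'a \<Rightarrow> real) \<Rightarrow> 'a \<Rightarrow> 'a pmf" where
  "step_law X p x = embed_pmf (\<lambda>y. if y \<in> X then p x y else 0)"

text \<open>The joint law of the first \<open>n + 1\<close> positions \<open>[Z\<^sub>0, \<dots>, Z\<^sub>n]\<close> of the walk started at \<open>x\<close>.\<close>

primrec path_law :: "'a set \<Rightarrow> ('a \<Rightarrow> 'a \<Rightarrow> real) \<Rightarrow> 'a \<Rightarrow> nat \<Rightarrow> 'a list pmf" where
  "path_law X p x 0 = return_pmf [x]"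
| "path_law X p x (Suc n) =
     bind_pmf (path_law X p x n) (\<lambda>w. map_pmf (\<lambda>y. w @ [y]) (step_law X p (last w)))"

text \<open>\<open>first_return X p x n\<close> is $f^{(n)}(x,x)$; only \<open>n \<ge> 1\<close> is used.\<close>

definition first_return :: "'a set \<Rightarrow> ('a \<Rightarrow> 'a \<Rightarrow> real) \<Rightarrow> 'a \<Rightarrow> nat \<Rightarrow> real" where
  "first_return X p x n =
     measure_pmf.prob (path_law X p x n) {w. w ! n = x \<and> (\<forall>i. 1 \<le> i \<and> i < n \<longrightarrow> w ! i \<noteq> x)}"

definition return_prob :: "'a set \<Rightarrow> ('a \<Rightarrow> 'a \<Rightarrow> real) \<Rightarrow> 'a \<Rightarrow> real" where
  "return_prob X p x = (\<Sum>n. first_return X p x (Suc n))"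

text \<open>
  The series defining \<^const>\<open>return_prob\<close> converges and its value lies in $[0,1]$, so the
  totalised \<^const>\<open>suminf\<close> is the actual sum.
\<close>

lemma length_path_law: "w \<in> set_pmf (path_law X p x n) \<Longrightarrow> length w = Suc n"
  by (induction n arbitrary: w) auto

lemma path_law_take: "map_pmf (take (Suc n)) (path_law X p x (n + k)) = path_law X p x n"
proof (induction k)
  case 0
  have "map_pmf (take (Suc n)) (path_law X p x n) = map_pmf id (path_law X p x n)"
    by (intro map_pmf_cong) (auto dest: length_path_law)
  then show ?case by simp
next
  case (Suc k)
  have "map_pmf (take (Suc n)) (path_law X p x (n + Suc k)) =
    bind_pmf (path_law X p x (n + k))
      (\<lambda>w. map_pmf (\<lambda>y. take (Suc n) (w @ [y])) (step_law X p (last w)))"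
    by (simp add: map_bind_pmf pmf.map_comp o_def)
  also have "\<dots> = bind_pmf (path_law X p x (n + k)) (\<lambda>w. return_pmf (take (Suc n) w))"
    by (intro bind_pmf_cong) (auto dest: length_path_law)
  also have "\<dots> = path_law X p x n"
    using Suc by (simp add: map_pmf_def)
  finally show ?case .
qed

lemma first_return_horizon:
  assumes "n \<le> N"
  shows "first_return X p x n =
    measure_pmf.prob (path_law X p x N) {w. w ! n = x \<and> (\<forall>i. 1 \<le> i \<and> i < n \<longrightarrow> w ! i \<noteq> x)}"
proof -
  obtain k where "N = n + k"
    using assms le_Suc_ex by blast
  then have "path_law X p x n = map_pmf (take (Suc n)) (path_law X p x N)"
    by (simp add: path_law_take)
  then show ?thesis
    by (simp add: first_return_def vimage_def)
qed

lemma sum_first_return_le_1: "(\<Sum>n<N. first_return X p x (Suc n)) \<le> 1"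
proof -
  let ?A = "\<lambda>n. {w. w ! Suc n = x \<and> (\<forall>i. 1 \<le> i \<and> i < Suc n \<longrightarrow> w ! i \<noteq> x)}"
  have "disjoint_family_on ?A {..<N}"
    unfolding disjoint_family_on_def
  proof (intro ballI impI)
    fix m n :: nat assume "m \<noteq> n"
    then show "?A m \<inter> ?A n = {}"
      by (cases "m < n") auto
  qed
  then have "(\<Sum>n<N. measure_pmf.prob (path_law X p x N) (?A n)) =
      measure_pmf.prob (path_law X p x N) (\<Union>n<N. ?A n)"
    by (intro measure_pmf.finite_measure_finite_Union[symmetric]) auto
  also have "\<dots> \<le> 1" by simp
  finally show ?thesis
    by (simp add: first_return_horizon[of _ N])
qed

lemma first_return_nonneg: "0 \<le> first_return X p x n"
  by (simp add: first_return_def)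

lemma summable_first_return: "summable (\<lambda>n. first_return X p x (Suc n))"
  by (rule summableI_nonneg_bounded[where x = 1])
    (simp_all only: sum_first_return_le_1 first_return_nonneg)

lemma return_prob_nonneg: "0 \<le> return_prob X p x"
  unfolding return_prob_def
  by (rule suminf_nonneg[OF summable_first_return first_return_nonneg])

lemma return_prob_le_1: "return_prob X p x \<le> 1"
  unfolding return_prob_def
  by (rule suminf_le_const[OF summable_first_return sum_first_return_le_1])


section \<open>Classification on the average\<close>

definition infL :: "'a pair_pre_digraph \<Rightarrow> 'a \<Rightarrow> ('a \<Rightarrow> real) \<Rightarrow> ereal" where
  "infL G c f =
     liminf (\<lambda>n. ereal ((\<Sum>x\<in>graph_ball G c n. f x) / real (card (graph_ball G c n))))"

definition TOA :: "'a pair_pre_digraph \<Rightarrow> ('a \<Rightarrow> 'a \<Rightarrow> real) \<Rightarrow> 'a \<Rightarrow> bool" where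
  "TOA G p c \<longleftrightarrow> infL G c (return_prob (pverts G) p) < 1"

definition ROA :: "'a pair_pre_digraph \<Rightarrow> ('a \<Rightarrow> 'a \<Rightarrow> real) \<Rightarrow> 'a \<Rightarrow> bool" where
  "ROA G p c \<longleftrightarrow> infL G c (return_prob (pverts G) p) = 1"

end

theory Submission
  imports Defs
begin

text \<open>
  Write \<open>h = 1 - F\<close>, a function with values in $[0,1]$; TOA means that the averages of \<open>h\<close> over
  balls do not tend to \<open>0\<close>. If \<open>d\<close> is at least the distance of the two centres, then
  $B(c,n) \subseteq B(c',n+d)$, and the growth condition yields a constant \<open>K\<close> with
  $|B(c',n+d)| \le K\,|B(c,n)|$ for large \<open>n\<close>. As \<open>h \<ge> 0\<close>, the average of \<open>h\<close> over $B(c',n+d)$ is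
  at least $1/K$ times its average over $B(c,n)$.
\<close>

section \<open>Balls in locally finite graphs\<close>

context pair_wf_digraph
begin

text \<open>The distance is an infimum of walk lengths, and these are natural numbers, so a bound
  \<open>n\<close> on the infimum is met by an actual walk. Balls can thus be handled through
  walks.\<close>

lemma graph_dist_le_iff:
  "graph_dist G x y \<le> ereal (real n) \<longleftrightarrow> (\<exists>p. awalk x p y \<and> length p \<le> n)"
proof -
  have cost: "awalk_cost (\<lambda>_. 1) p = real (length p)" for p :: "('a \<times> 'a) list"
    by (simp add: awalk_cost_def sum_list_triv)
  have dist: "graph_dist G x y = (INF p\<in>{p. awalk x p y}. ereal (real (length p)))"
    by (simp add: graph_dist_def \<mu>_def cost)
  show ?thesis
  proof
    assume le: "graph_dist G x y \<le> ereal (real n)"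
    show "\<exists>p. awalk x p y \<and> length p \<le> n"
    proof (rule ccontr)
      assume "\<not> ?thesis"
      \<comment> \<open>Every walk has length at least \<open>n + 1\<close>; with no walk at all the
        infimum is infinite.\<close>
      then have "ereal (real (Suc n)) \<le> graph_dist G x y"
        unfolding dist by (intro INF_greatest) (auto simp: not_le Suc_le_eq)
      then have "ereal (real (Suc n)) \<le> ereal (real n)"
        using le by (rule order_trans)
      then show False by simp
    qed
  next
    assume "\<exists>p. awalk x p y \<and> length p \<le> n"
    then show "graph_dist G x y \<le> ereal (real n)"
      unfolding dist by (auto intro: INF_lower2)
  qed
qed

lemma mem_graph_ball_iff:
  "y \<in> graph_ball G x n \<longleftrightarrow> (\<exists>p. awalk x p y \<and> length p \<le> n)"
  by (auto simp: graph_ball_def graph_dist_le_iff)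

lemma center_in_graph_ball: "x \<in> pverts G \<Longrightarrow> x \<in> graph_ball G x n"
  unfolding mem_graph_ball_iff by (rule exI[of _ "[]"]) (simp add: awalk_Nil_iff)

lemma graph_ball_trans:
  assumes "y \<in> graph_ball G x m"
  shows "graph_ball G y n \<subseteq> graph_ball G x (m + n)"
proof
  fix z assume "z \<in> graph_ball G y n"
  then obtain p q where "awalk x p y" "length p \<le> m" "awalk y q z" "length q \<le> n"
    using assms by (auto simp: mem_graph_ball_iff)
  then have "awalk x (p @ q) z" "length (p @ q) \<le> m + n"
    by auto
  then show "z \<in> graph_ball G x (m + n)"
    by (auto simp only: mem_graph_ball_iff)
qed

text \<open>By integrality of walk lengths, a vertex outside the smaller ball is at distance at
  least \<open>n + 1\<close>.\<close>

lemma graph_ball_Suc_subset: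
  "graph_ball G x (Suc n) \<subseteq> graph_ball G x n \<union> graph_sphere G x (Suc n)"
proof
  fix y assume y: "y \<in> graph_ball G x (Suc n)"
  show "y \<in> graph_ball G x n \<union> graph_sphere G x (Suc n)"
  proof (cases "y \<in> graph_ball G x n")
    case False
    have "ereal (real (Suc n)) \<le> graph_dist G x y"
      unfolding graph_dist_def \<mu>_def
      using False
      by (intro INF_greatest)
        (auto simp: mem_graph_ball_iff awalk_cost_def sum_list_triv not_le Suc_le_eq)
    with y show ?thesis
      by (auto simp: graph_ball_def graph_sphere_def)
  qed simp
qed

text \<open>Splitting off the last arc of a walk shows that each new vertex is the head of one of
  the finitely many arcs leaving the previous ball.\<close>

lemma finite_graph_ball:
  assumes "locally_finite_graph G"
  shows "finite (graph_ball G x n)"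
proof (induction n)
  case 0
  have "graph_ball G x 0 \<subseteq> {x}"
    by (auto simp: mem_graph_ball_iff awalk_Nil_iff)
  then show ?case
    by (rule finite_subset) simp
next
  case (Suc n)
  let ?N = "\<Union>z\<in>graph_ball G x n. snd ` out_arcs (with_proj G) z"
  have "graph_ball G x (Suc n) \<subseteq> graph_ball G x n \<union> ?N"
  proof
    fix y assume "y \<in> graph_ball G x (Suc n)"
    then obtain p where p: "awalk x p y" "length p \<le> Suc n"
      by (auto simp: mem_graph_ball_iff)
    show "y \<in> graph_ball G x n \<union> ?N"
    proof (cases p rule: rev_cases)
      case Nil
      with p show ?thesis
        by (auto simp: mem_graph_ball_iff)
    next
      case (snoc q e)
      with p have "awalk x q (fst e)" "length q \<le> n" "e \<in> parcs G" "snd e = y"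
        by (auto simp: awalk_Cons_iff awalk_Nil_iff)
      then have "fst e \<in> graph_ball G x n" "e \<in> out_arcs (with_proj G) (fst e)"
        by (auto simp: mem_graph_ball_iff)
      with \<open>snd e = y\<close> show ?thesis by blast
    qed
  qed
  moreover have "finite ?N"
    using Suc assms
    by (auto simp: locally_finite_graph_def graph_ball_def)
  ultimately show ?case
    using Suc by (meson finite_UnI finite_subset)
qed

lemma card_graph_ball_pos:
  assumes "locally_finite_graph G" "x \<in> pverts G"
  shows "0 < card (graph_ball G x n)"
  using finite_graph_ball[OF assms(1)] center_in_graph_ball[OF assms(2)]
  by (auto simp: card_gt_0_iff)

text \<open>Adding one sphere multiplies the cardinality by at most \<open>1 + M\<close>; this is
  iterated \<open>k\<close> times.\<close>

lemma card_graph_ball_growth: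
  assumes lf: "locally_finite_graph G" and x: "x \<in> pverts G"
    and M: "\<And>n. real (card (graph_sphere G x (Suc n))) / real (card (graph_ball G x n)) \<le> M"
  shows "real (card (graph_ball G x (n + k))) \<le> (1 + M) ^ k * real (card (graph_ball G x n))"
proof (induction k)
  case (Suc k)
  let ?B = "graph_ball G x (n + k)" and ?S = "graph_sphere G x (Suc (n + k))"
  have "0 \<le> M"
    using M[of 0] by (rule order_trans[rotated]) simp
  have "?S \<subseteq> graph_ball G x (Suc (n + k))"
    by (auto simp: graph_ball_def graph_sphere_def)
  then have "finite ?S"
    using finite_graph_ball[OF lf] by (rule finite_subset)
  then have "card (graph_ball G x (Suc (n + k))) \<le> card ?B + card ?S"
    by (meson card_Un_le card_mono finite_UnI finite_graph_ball[OF lf] graph_ball_Suc_subset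
        order_trans)
  moreover have "real (card ?S) \<le> M * real (card ?B)"
    using M[of "n + k"] card_graph_ball_pos[OF lf x, of "n + k"] by (simp add: divide_le_eq)
  ultimately have "real (card (graph_ball G x (Suc (n + k)))) \<le> (1 + M) * real (card ?B)"
    by (simp add: algebra_simps)
  also have "\<dots> \<le> (1 + M) * ((1 + M) ^ k * real (card (graph_ball G x n)))"
    using Suc \<open>0 \<le> M\<close> by (intro mult_left_mono) auto
  finally show ?case by (simp add: mult.assoc)
qed simp

end

section \<open>Comparison of balls with different centres\<close>

lemma (in pair_sym_digraph) connected_graph_ballE:
  assumes "connected (with_proj G)" "x \<in> pverts G" "y \<in> pverts G"
  obtains d where "y \<in> graph_ball G x d"
proof -
  have "strongly_connected (with_proj G)"
    using symmetric_connected_imp_strongly_connected pair_sym_arcs assms(1) by blast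
  then have "x \<rightarrow>\<^sup>*\<^bsub>with_proj G\<^esub> y"
    using assms(2,3) by (auto simp: strongly_connected_def)
  then obtain p where "awalk x p y"
    using reachable_awalk by auto
  then show thesis
    by (intro that[of "length p"]) (auto simp: mem_graph_ball_iff)
qed

text \<open>Both balls are compared with balls around the vertex \<open>x\<close> of the growth
  condition: one around \<open>x\<close> contains the ball at \<open>c'\<close>, a smaller one lies
  in the ball at \<open>c\<close>. Their radii differ by a constant, so \<open>K\<close> does not
  depend on \<open>n\<close>.\<close>

lemma (in pair_sym_digraph) card_graph_ball_change_center:
  assumes conn: "connected (with_proj G)" and lf: "locally_finite_graph G"
    and bound: "\<exists>x\<in>pverts G.
      (SUP n. ereal (real (card (graph_sphere G x (n + 1))) / real (card (graph_ball G x n)))) < \<infinity>"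
    and c: "c \<in> pverts G" "c' \<in> pverts G"
  obtains K m where "0 < K"
    and "\<And>n. m \<le> n \<Longrightarrow>
      real (card (graph_ball G c' (n + d))) \<le> K * real (card (graph_ball G c n))"
proof -
  obtain x where x: "x \<in> pverts G"
    and sup: "(SUP n. ereal (real (card (graph_sphere G x (n + 1))) /
      real (card (graph_ball G x n)))) < \<infinity>" (is "?S < \<infinity>")
    using bound by blast
  define M where "M = real_of_ereal ?S"
  have le_sup: "ereal (real (card (graph_sphere G x (n + 1))) / real (card (graph_ball G x n))) \<le> ?S"
    for n by (rule SUP_upper) simp
  \<comment> \<open>Being nonnegative and below infinity, the supremum is a real number, so
    \<open>M\<close> is its true value and not the default \<open>0\<close> of
    \<open>real_of_ereal\<close>.\<close>
  then have "0 \<le> ?S"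
    by (rule order_trans[rotated, of _ _ 0]) simp
  then have "?S = ereal M"
    using sup unfolding M_def by (intro ereal_real'[symmetric]) auto
  then have M: "real (card (graph_sphere G x (Suc n))) / real (card (graph_ball G x n)) \<le> M" for n
    using le_sup[of n] by simp
  obtain a where a: "c' \<in> graph_ball G x a"
    using connected_graph_ballE conn x c by blast
  obtain b where b: "x \<in> graph_ball G c b"
    using connected_graph_ballE conn x c by blast
  have "0 \<le> M"
    using M[of 0] by (rule order_trans[rotated]) simp
  show thesis
  proof (rule that)
    show "0 < (1 + M) ^ (a + b + d)"
      using \<open>0 \<le> M\<close> by simp
  next
    \<comment> \<open>The threshold \<open>m\<close> is \<open>b\<close>: it leaves a radius
      \<open>k = n - b\<close> for which the ball around \<open>x\<close> fits into the ball of
      radius \<open>n\<close> around \<open>c\<close>.\<close>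
    fix n assume "b \<le> n"
    then obtain k where n: "n = b + k"
      using le_Suc_ex by blast
    have "real (card (graph_ball G c' (n + d))) \<le> real (card (graph_ball G x (a + (n + d))))"
      using card_mono[OF finite_graph_ball[OF lf] graph_ball_trans[OF a]] by simp
    \<comment> \<open>The radius \<open>a + (n + d)\<close> equals
      \<open>k + (a + b + d)\<close>.\<close>
    also have "\<dots> \<le> (1 + M) ^ (a + b + d) * real (card (graph_ball G x k))"
      using card_graph_ball_growth[OF lf x M, of k "a + b + d"] by (simp add: n algebra_simps)
    also have "\<dots> \<le> (1 + M) ^ (a + b + d) * real (card (graph_ball G c n))"
      using card_mono[OF finite_graph_ball[OF lf] graph_ball_trans[OF b, of k]] \<open>0 \<le> M\<close>
      by (intro mult_left_mono) (auto simp: n)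
    finally show "real (card (graph_ball G c' (n + d)))
      \<le> (1 + M) ^ (a + b + d) * real (card (graph_ball G c n))" .
  qed
qed

section \<open>Averages over balls\<close>

text \<open>The deficit \<open>1 - f\<close> is nonnegative, so its sum over \<open>B\<close> is at
  least its sum over \<open>A\<close>, hence at least \<open>e\<close> times the size of
  \<open>A\<close>; passing to the size of \<open>B\<close> costs a factor \<open>K\<close>.\<close>

lemma average_superset_le:
  fixes f :: "'a \<Rightarrow> real"
  assumes "finite B" "A \<subseteq> B" "A \<noteq> {}" and K: "real (card B) \<le> K * real (card A)" "0 < K"
    and f: "\<And>x. f x \<le> 1" and "0 \<le> e"
    and avg: "(\<Sum>x\<in>A. f x) / real (card A) \<le> 1 - e"
  shows "(\<Sum>x\<in>B. f x) / real (card B) \<le> 1 - e / K"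
proof -
  have pos: "0 < real (card A)" "0 < real (card B)"
    using assms by (auto simp: card_gt_0_iff intro: finite_subset)
  have "e / K * real (card B) \<le> e / K * (K * real (card A))"
    using K \<open>0 \<le> e\<close> by (intro mult_left_mono) auto
  also have "\<dots> = e * real (card A)"
    using K by simp
  also have "\<dots> \<le> (\<Sum>x\<in>A. 1 - f x)"
    using iffD1[OF pos_divide_le_eq[OF pos(1)] avg] by (simp add: sum_subtractf algebra_simps)
  also have "\<dots> \<le> (\<Sum>x\<in>B. 1 - f x)"
    using assms by (intro sum_mono2) auto
  finally show ?thesis
    unfolding pos_divide_le_eq[OF pos(2)] by (simp add: sum_subtractf algebra_simps)
qed

lemma infL_le_1:
  assumes "\<And>x. f x \<le> 1"
  shows "infL G c f \<le> 1"
proof -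
  \<comment> \<open>For empty or infinite \<open>A\<close> the divisor is \<open>0\<close>, and so
    is the quotient.\<close>
  have "(\<Sum>x\<in>A. f x) / real (card A) \<le> 1" for A
    using sum_bounded_above[of A f 1] assms by (auto simp: divide_le_eq_1)
  then have "infL G c f \<le> liminf (\<lambda>_. 1 :: ereal)"
    unfolding infL_def by (intro Liminf_mono) (simp add: one_ereal_def)
  then show ?thesis
    by (simp add: Liminf_const)
qed

text \<open>A deficit \<open>e\<close> of the average at \<open>c\<close> would force the deficit
  \<open>e / K\<close> at \<open>c'\<close> for radius \<open>n + d\<close>, which is excluded for
  large \<open>n\<close>.\<close>

lemma (in pair_sym_digraph) infL_ge_1_change_center:
  assumes conn: "connected (with_proj G)" and lf: "locally_finite_graph G"
    and bound: "\<exists>x\<in>pverts G.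
      (SUP n. ereal (real (card (graph_sphere G x (n + 1))) / real (card (graph_ball G x n)))) < \<infinity>"
    and c: "c \<in> pverts G" "c' \<in> pverts G"
    and f: "\<And>x. f x \<le> 1" and ge: "1 \<le> infL G c' f"
  shows "1 \<le> infL G c f"
  unfolding infL_def le_Liminf_iff
proof (intro allI impI)
  let ?avg = "\<lambda>c n. (\<Sum>x\<in>graph_ball G c n. f x) / real (card (graph_ball G c n))"
  fix y :: ereal assume "y < 1"
  obtain d where d: "c \<in> graph_ball G c' d"
    using connected_graph_ballE conn c by blast
  obtain K m where K: "0 < K"
    "\<And>n. m \<le> n \<Longrightarrow> real (card (graph_ball G c' (n + d))) \<le> K * real (card (graph_ball G c n))"
    using card_graph_ball_change_center[OF conn lf bound c] by blast
  show "\<forall>\<^sub>F n in sequentially. y < ereal (?avg c n)"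
  proof (cases y)
    case (real r)
    define e where "e = 1 - r"
    have "0 < e"
      using \<open>y < 1\<close> by (simp add: real e_def)
    then have "ereal (1 - e / K) < 1"
      using K(1) by simp
    with ge have "\<forall>\<^sub>F n in sequentially. ereal (1 - e / K) < ereal (?avg c' n)"
      unfolding infL_def le_Liminf_iff by blast
    \<comment> \<open>Shifting the index by the constant \<open>d\<close> does not affect an
      eventual property.\<close>
    then have "\<forall>\<^sub>F n in sequentially. 1 - e / K < ?avg c' (n + d)"
      by (simp add: eventually_sequentially_seg[where P = "\<lambda>n. 1 - e / K < ?avg c' n"])
    with eventually_ge_at_top[of m] show ?thesis
    proof eventually_elim
      case (elim n)
      have "graph_ball G c n \<subseteq> graph_ball G c' (n + d)"
        using graph_ball_trans[OF d, of n] by (simp add: add.commute)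
      then have "\<not> ?avg c n \<le> 1 - e"
        using average_superset_le[OF finite_graph_ball[OF lf] _ _ K(2)[OF elim(1)] K(1) f, of e]
          center_in_graph_ball[OF c(1), of n] \<open>0 < e\<close> elim(2) by fastforce
      then show ?case
        by (simp add: real e_def)
    qed
  \<comment> \<open>Minus infinity lies below every real average, and plus infinity contradicts
    \<open>y < 1\<close>.\<close>
  qed (use \<open>y < 1\<close> in auto)
qed

theorem proposition3p3:
  fixes G :: "'a pair_pre_digraph"
  assumes "pair_sym_digraph G"
    and "infinite (pverts G)"
    and "Digraph_Component.connected (with_proj G)"
    and "locally_finite_graph G"
    and "\<exists>x\<in>pverts G.
           (SUP n. ereal (real (card (graph_sphere G x (n + 1))) / real (card (graph_ball G x n)))) < \<infinity>"
  shows "\<forall>p. stochastic_matrix (pverts G) p \<longrightarrow>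
           (\<forall>c\<in>pverts G. \<forall>c'\<in>pverts G.
              (TOA G p c \<longleftrightarrow> TOA G p c') \<and> (ROA G p c \<longleftrightarrow> ROA G p c'))"
proof (intro allI impI ballI)
  fix p c c' assume c: "c \<in> pverts G" "c' \<in> pverts G"
  let ?F = "return_prob (pverts G) p"
  interpret pair_sym_digraph G by fact
  note ge_1 = infL_ge_1_change_center[OF assms(3-5), where f = ?F, OF _ _ return_prob_le_1]
  have "1 \<le> infL G c ?F \<longleftrightarrow> 1 \<le> infL G c' ?F"
    by (rule iffI) (fact ge_1[OF c(2,1)], fact ge_1[OF c])
  \<comment> \<open>As \<open>infL\<close> never exceeds \<open>1\<close>, ROA is the inequality
    \<open>1 \<le> infL\<close> and TOA its negation, so one equivalence settles both
    claims.\<close>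
  moreover have "ROA G p z \<longleftrightarrow> 1 \<le> infL G z ?F" for z
    unfolding ROA_def
    by (rule iffI[OF eq_refl[OF sym] antisym[OF infL_le_1[OF return_prob_le_1]]])
  moreover have "TOA G p z \<longleftrightarrow> \<not> 1 \<le> infL G z ?F" for z
    by (simp add: TOA_def not_le)
  ultimately show "(TOA G p c \<longleftrightarrow> TOA G p c') \<and> (ROA G p c \<longleftrightarrow> ROA G p c')"
    by simp
qed

end
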